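(* Let $R$ be a ring satisfying $[x^8-x,y]=0$ for all $x,y\in R$. Then $R$ is commutative.
   Context: Rings are associative but are not assumed to have a unity. For $x,y$ in a ring, $[x,y]=xy-yx$. *)

theory Defs
  imports Main
begin

text \<open>Class \<^class>\<open>ring\<close> is that of associative rings that need not have a unity. Without
  a unity the library's power operation is not available, so the eighth power is spelled out.\<close>

definition eighth_power :: "'a::ring \<Rightarrow> 'a"
  where "eighth_power x = x * x * x * x * x * x * x * x"

definition commutator :: "'a::ring \<Rightarrow> 'a \<Rightarrow> 'a"
  where "commutator x y = x * y - y * x"

end

theory Submission
  imports Defs
begin

text \<open>Since \<open>(-x)\<^sup>8 = x\<^sup>8\<close>, every \<open>2x\<close> is central, so if \<open>R/2R\<close> is commutative then commutators
  of \<open>R\<close> are central and of additive order 2; this makes squares central, hence \<open>x\<^sup>8\<close> and \<open>x\<close>.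
  One may therefore pass to \<open>R/2R\<close> and, keeping the hypothesis, adjoin a unity to it.

  In characteristic 2 the derivation \<open>d = [x, _]\<close> satisfies \<open>d\<^sup>2 = [x\<^sup>2, _]\<close>, hence \<open>d\<^sup>8 = d\<close>, so
  \<open>d\<close> is injective on its image. Applied to \<open>[u, _]\<close>, this shows that \<open>[x, u] = u\<close> forces \<open>u = 0\<close>.
  Elements of square zero are central because their eighth power vanishes. A commutator
  \<open>u = [x, y]\<close> is now split according to the factorization of \<open>X\<^sup>8 + X\<close> over \<open>F\<^sub>2\<close>, acting on \<open>u\<close> by
  multiplication with central elements and by left and right multiplication with \<open>x\<close>, and each
  component is killed: coprime left and right factors give a component of square zero, and equal
  cubic factors give some \<open>v\<close> with \<open>x v = v x\<^sup>2\<close> or \<open>x v = v x\<^sup>4\<close>, and then centrality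
  of \<open>v\<^sup>8 + v\<close> makes \<open>v\<^sup>2 = 0\<close>.\<close>

section \<open>Commutators in characteristic two\<close>

class char2_ring = ring +
  assumes double_eq_0 [simp]: "x + x = 0"
begin

lemma double_left [simp]: "x + (x + y) = y"
  by (metis add_0_left add.assoc double_eq_0)

lemma uminus_char2 [simp]: "- x = x"
  by (metis double_eq_0 add.inverse_unique)

lemma minus_char2 [simp]: "x - y = x + y"
  by (metis uminus_char2 add_uminus_conv_diff)

lemma add_eq_0_char2: "x + y = 0 \<longleftrightarrow> x = y"
  by (metis minus_char2 right_minus_eq)

lemma add_exchange_char2:
  assumes "a + b = c + d"
  shows "a + c = b + d"
proof -
  have "b = a + (c + d)" using double_left[of a b] assms by simp
  then show ?thesis by (simp add: add.assoc)
qed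

end

lemma commutator_char2: "commutator x (y::'a::char2_ring) = x * y + y * x"
  by (simp add: commutator_def)

lemma commutator_add_right: "commutator x (y + z) = commutator x y + commutator x z"
  by (simp add: commutator_def algebra_simps)

lemma commutator_sq:
  "commutator (x\<^sup>2) y = commutator x (commutator x (y::'a::{char2_ring,ring_1}))"
  by (simp add: commutator_char2 power2_eq_square algebra_simps)

lemma commutator_eq_0_iff: "commutator x y = 0 \<longleftrightarrow> x * y = y * x"
  by (simp add: commutator_def)

locale eighth_power_central =
  fixes R :: "'a::{char2_ring,ring_1} itself"
  assumes eighth_central: "commutator (x ^ 8) (y::'a) = commutator x y"
begin

lemma commutator_iter8:
  "commutator x (commutator x (commutator x (commutator x (commutator x (commutator x
     (commutator x (commutator x (y::'a)))))))) = commutator x y"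
proof -
  have "x ^ 8 = ((x\<^sup>2)\<^sup>2)\<^sup>2" by simp
  then show ?thesis using eighth_central[of x y] by (simp only: commutator_sq)
qed

lemma commutator_kernel:
  assumes "commutator x (commutator x (y::'a)) = 0"
  shows "commutator x y = 0"
  using commutator_iter8[of x y] by (simp add: assms) (simp add: commutator_def)

lemma square_zero_central:
  assumes "(u::'a)\<^sup>2 = 0"
  shows "commutator u y = 0"
proof -
  have "u ^ 8 = (u\<^sup>2) ^ 4" by (simp only: power_mult[symmetric]) simp
  then have "u ^ 8 = 0" using assms by simp
  then show ?thesis using eighth_central[of u y] by (simp add: commutator_def)
qed

lemma commutator_square_zero:
  assumes "(commutator x (y::'a))\<^sup>2 = 0"
  shows "commutator x y = 0"
proof -
  have "commutator x (commutator x y) = 0"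
    using square_zero_central[OF assms, of x] by (simp add: commutator_eq_0_iff)
  then show ?thesis by (rule commutator_kernel)
qed

lemma no_eigenvalue_one:
  assumes "commutator x (u::'a) = u"
  shows "u = 0"
proof -
  have "commutator u x = u"
    using assms by (simp add: commutator_char2 add.commute)
  moreover have "commutator u u = 0" by (simp add: commutator_def)
  ultimately show ?thesis using commutator_kernel[of u x] by simp
qed

section \<open>Central elements acting on commutators\<close>

definition central :: "'a \<Rightarrow> bool" where "central z \<longleftrightarrow> (\<forall>y. z * y = y * z)"

lemma central_power: "central z \<Longrightarrow> central (z ^ n)"
  unfolding central_def by (blast intro: power_commuting_commutes)

lemma central_eighth: "central (x ^ 8 + x)"
  unfolding central_def distrib_left distrib_right
proof
  show "x ^ 8 * y + x * y = y * x ^ 8 + y * x" for y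
    using eighth_central[of x y] unfolding commutator_char2 by (rule add_exchange_char2)
qed

lemma commutator_central_left:
  assumes "central z"
  shows "commutator (z * x) y = z * commutator x y"
  using assms by (auto simp: central_def commutator_def algebra_simps)

lemma commutator_central_right:
  assumes "central z"
  shows "commutator x (z * y) = z * commutator x y"
  using assms by (auto simp: central_def commutator_def algebra_simps)

text \<open>The hypothesis for \<open>z * x\<close> and for \<open>x\<close> gives
  \<open>z^8 [x, y] = [z^8 x^8, y] = [z x, y] = z [x, y]\<close>.\<close>

lemma central_eighth_power:
  assumes "central z"
  shows "z ^ 8 * commutator x y = z * commutator x y"
proof -
  have "(z * x) ^ n = z ^ n * x ^ n" for n
  proof (induction n)
    case (Suc n)
    have "x * z ^ n = z ^ n * x"
      using central_power[OF assms, of n] by (simp add: central_def)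
    then show ?case by (simp add: Suc mult.assoc) (simp flip: mult.assoc)
  qed simp
  then have "commutator (z ^ 8 * x ^ 8) y = commutator (z * x) y"
    using eighth_central[of "z * x" y] by simp
  then show ?thesis
    by (simp add: commutator_central_left central_power assms eighth_central)
qed

text \<open>\<open>z\<close> acts invertibly on \<open>u\<close>, so multiplying \<open>x\<close> by
  \<open>z ^ (7 - i)\<close> normalizes the eigenvalue to 1.\<close>

lemma no_central_eigenvalue:
  assumes "central z" "z ^ 7 * u = u" "i \<le> 7" "commutator x u = z ^ i * u"
  shows "u = 0"
proof (rule no_eigenvalue_one)
  have "z ^ (7 - i) * z ^ i = z ^ 7" using \<open>i \<le> 7\<close> by (simp flip: power_add)
  then show "commutator (z ^ (7 - i) * x) u = u"
    using assms by (simp add: commutator_central_left central_power flip: mult.assoc)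
qed

text \<open>Here \<open>z\<close> acts as an element of the field with 8 elements, so the operator \<open>d\<^sup>7 + 1\<close>, which
  kills \<open>u\<close>, is the product of the \<open>d + z\<^sup>i\<close> for \<open>0 \<le> i < 7\<close>, and each of these is injective.\<close>

lemma central_cubic_root:
  assumes z: "central z" and u: "u = commutator x y" and root: "z ^ 3 * u = z * u + u"
  shows "u = 0"
proof -
  define d where "d = commutator x"
  define Q where "Q v \<longleftrightarrow> z * (z * (z * v)) = z * v + v" for v
  define f where "f i v = d v + z ^ i * v" for i v
  have d_add: "d (v + w) = d v + d w" for v w
    by (simp add: d_def commutator_add_right)
  have d_z: "d (z * v) = z * d v" for v
    by (simp add: d_def commutator_central_right z)
  have Qd: "Q (d v)" if "Q v" for v
    using that unfolding Q_def by (metis d_add d_z)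
  have Qz: "Q (z ^ i * v)" if "Q v" for i v
    using that unfolding Q_def
    by (metis (no_types) mult.assoc distrib_left power_commutes)
  have Qf: "Q (f i v)" if "Q v" for i v
    using Qd[OF that] Qz[OF that, of i] by (simp add: Q_def f_def distrib_left ac_simps)
  have z7: "z ^ 7 * v = v" if "Q v" for v
    using that by (simp add: Q_def eval_nat_numeral mult.assoc distrib_left ac_simps)
  have inj: "v = 0" if "Q v" "f i v = 0" "i \<le> 7" for i v
    using that z7[of v] by (intro no_central_eigenvalue[OF z, of v i x])
      (simp_all add: f_def d_def add_eq_0_char2)
  \<comment> \<open>The exponents 1, 2, 4 and 3, 6, 5 are orbits of doubling modulo 7, so each
    product has coefficients in \<open>F_2\<close>: it is a cubic factor of \<open>X^7 + 1\<close>
    evaluated at \<open>d\<close>.\<close>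
  have f124: "f 4 (f 2 (f 1 v)) = d (d (d v)) + d v + v" if "Q v" for v
    using that Qd[of v] Qd[of "d v"]
    by (simp add: f_def Q_def d_add d_z eval_nat_numeral mult.assoc distrib_left ac_simps)
  have f365: "f 5 (f 6 (f 3 v)) = d (d (d v)) + d (d v) + v" if "Q v" for v
    using that Qd[of v] Qd[of "d v"]
    by (simp add: f_def Q_def d_add d_z eval_nat_numeral mult.assoc distrib_left ac_simps)
  have Qu: "Q u" using root by (simp add: Q_def eval_nat_numeral mult.assoc)
  have "d (d (d (d (d (d (d u)))))) = u"
    using commutator_iter8[of x y] by (simp add: u d_def)
  moreover define a where "a = f 4 (f 2 (f 1 u))"
  have "a = d (d (d u)) + d u + u" unfolding a_def by (rule f124[OF Qu])
  moreover have "Q a" unfolding a_def by (intro Qf Qu)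
  ultimately have "f 0 (f 5 (f 6 (f 3 a))) = 0"
    by (simp add: f365) (simp add: f_def d_add ac_simps)
  then have "f 5 (f 6 (f 3 a)) = 0" by (rule inj[rotated]) (simp, intro Qf \<open>Q a\<close>)
  then have "f 6 (f 3 a) = 0" by (rule inj[rotated]) (simp, intro Qf \<open>Q a\<close>)
  then have "f 3 a = 0" by (rule inj[rotated]) (simp, intro Qf \<open>Q a\<close>)
  then have "a = 0" by (rule inj[rotated]) (simp, rule \<open>Q a\<close>)
  then have "f 2 (f 1 u) = 0" unfolding a_def by (rule inj[rotated]) (simp, intro Qf Qu)
  then have "f 1 u = 0" by (rule inj[rotated]) (simp, intro Qf Qu)
  then show "u = 0" by (rule inj[rotated]) (simp, rule Qu)
qed

lemma central_add: "central a \<Longrightarrow> central b \<Longrightarrow> central (a + b)"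
  by (simp add: central_def algebra_simps)

text \<open>\<open>z\<^sup>8 + z\<close> factors as \<open>(z\<^sup>2 + z) (z\<^sup>3 + z + 1) (z\<^sup>3 + z\<^sup>2 + 1)\<close>, and the cube of a root of the last
  factor is a root of the middle one.\<close>

lemma central_idempotent:
  assumes z: "central z"
  shows "z\<^sup>2 * commutator x y = z * commutator x y"
proof -
  define u where "u = commutator x y"
  have z8: "z * (z * (z * (z * (z * (z * (z * (z * u))))))) = z * u"
    using central_eighth_power[OF z, of x y] by (simp add: u_def eval_nat_numeral mult.assoc)
  define c where "c = z\<^sup>2 + z"
  have c: "central c" by (simp add: c_def z central_add central_power)
  define b where "b = z ^ 3 + z\<^sup>2 + 1"
  have b: "central b" unfolding b_def
    by (intro central_add central_power z) (simp add: central_def)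
  have "b * (c * u) = 0"
  proof (rule central_cubic_root[OF z])
    show "b * (c * u) = commutator x (b * (c * y))"
      by (simp add: u_def commutator_central_right b c)
    show "z ^ 3 * (b * (c * u)) = z * (b * (c * u)) + b * (c * u)"
      by (simp add: b_def c_def z8 eval_nat_numeral algebra_simps)
  qed
  then have r: "z * (z * (z * (c * u))) = z * (z * (c * u)) + c * u"
    by (simp add: b_def eval_nat_numeral algebra_simps)
      (metis add.left_commute add.commute add_eq_0_char2)
  have "c * u = 0"
  proof (rule central_cubic_root)
    show "central (z ^ 3)" by (simp add: z central_power)
    show "c * u = commutator x (c * y)" by (simp add: u_def commutator_central_right c)
    show "(z ^ 3) ^ 3 * (c * u) = z ^ 3 * (c * u) + c * u"
      by (simp add: r eval_nat_numeral mult.assoc distrib_left ac_simps)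
  qed
  then show ?thesis by (simp add: c_def u_def distrib_right add_eq_0_char2)
qed

section \<open>Powers of x multiplying commutators from the left and right\<close>

lemma eighth_power_left_right:
  fixes x y :: 'a
  shows "x ^ 8 * commutator x y = x * commutator x y"
    and "commutator x y * x ^ 8 = commutator x y * x"
proof -
  txt \<open>On \<open>v = w [x, y]\<close> the central \<open>w\<close> acts as 1. Idempotency of \<open>x\<^sup>2\<^sup>4 + x\<^sup>3\<close> then leaves
    \<open>x\<^sup>2 + x + 1 = 0\<close> on both sides, so \<open>[x, _]\<close> acts on \<open>v\<close> as its own square.\<close>
  define w where "w = x ^ 8 + x"
  define w' where "w' = (x ^ 3) ^ 8 + x ^ 3"
  define v where "v = commutator x (w * y)"
  have w: "central w" and w': "central w'"
    unfolding w_def w'_def by (rule central_eighth)+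
  have v: "v = w * commutator x y" by (simp add: v_def commutator_central_right w)
  have wv: "w * v = v"
    using central_idempotent[OF w, of x y] by (simp add: v power2_eq_square mult.assoc)
  have w'v: "w' * (w' * v) = w' * v"
    using central_idempotent[OF w', of x "w * y"] by (simp add: v_def power2_eq_square mult.assoc)
  have vw: "v * w = v" using w wv by (simp add: central_def)
  have vw': "v * w' * w' = v * w'" using w' w'v by (metis central_def mult.assoc)
  have "x * (x * (x * (x * (x * (x * (x * (x * v))))))) = x * v + v"
    using wv by (simp add: w_def eval_nat_numeral algebra_simps) (metis add.commute double_left)
  note l8 = this
  \<comment> \<open>As \<open>x^8\<close> acts as \<open>x + 1\<close>, \<open>w'\<close> acts as
    \<open>(x + 1)^3 + x^3 = x^2 + x + 1\<close>. Idempotency of this says that \<open>x^4\<close>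
    acts as \<open>x\<close>, whence \<open>x^8\<close> acts as \<open>x^2\<close>.\<close>
  have l4: "x * (x * (x * (x * v))) = x * v"
    using w'v by (simp add: w'_def eval_nat_numeral algebra_simps l8)
  have "x * (x * v) = x * v + v"
    using l8 by (simp add: l4)
  moreover have r8: "v * x * x * x * x * x * x * x * x = v * x + v"
    using vw by (simp add: w_def eval_nat_numeral distrib_left distrib_right flip: mult.assoc)
      (metis add.commute double_left)
  have r4: "v * x * x * x * x = v * x"
    using vw'
    by (simp add: w'_def eval_nat_numeral distrib_left distrib_right r8 add_ac flip: mult.assoc)
  have "v * x * x = v * x + v"
    using r8 by (simp add: r4)
  ultimately have "commutator x (commutator x v) = commutator x v"
    unfolding commutator_sq[symmetric]
    by (simp add: commutator_char2 power2_eq_square distrib_left distrib_right)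
      (simp add: add_ac flip: mult.assoc)
  then have "commutator x v = 0" by (rule no_eigenvalue_one)
  then have "v = 0" unfolding v_def by (rule commutator_kernel)
  then have "w * commutator x y = 0" "commutator x y * w = 0"
    using v w by (simp_all add: central_def)
  then show "x ^ 8 * commutator x y = x * commutator x y"
    "commutator x y * x ^ 8 = commutator x y * x"
    by (simp_all add: w_def distrib_left distrib_right add_eq_0_char2)
qed

text \<open>The defect \<open>a\<close> is again a commutator with \<open>x\<close>, and
  \<open>x\<close> kills it on one side. Its product with \<open>x\<close> on the other side squares
  to 0, hence is central, and a further factor \<open>x\<close> on that side gives 0. The eighth
  power identity brings this down to a single \<open>x\<close>, so
  \<open>[x, a] = 0\<close>.\<close>

lemma seventh_power_left_right:
  fixes x y :: 'a
  shows "x ^ 7 * commutator x y = commutator x y"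
    and "commutator x y * x ^ 7 = commutator x y"
proof -
  define a where "a = commutator x (x ^ 7 * y + y)"
  have a: "a = x ^ 7 * commutator x y + commutator x y"
    by (simp add: a_def commutator_char2 eval_nat_numeral algebra_simps)
  have xa: "x * a = 0"
    using eighth_power_left_right(1)[of x y] by (simp add: a eval_nat_numeral algebra_simps)
  have "(a * x)\<^sup>2 = a * (x * a) * x" by (simp add: power2_eq_square mult.assoc)
  then have "commutator (a * x) x = 0" by (intro square_zero_central) (simp add: xa)
  then have "a * x * x = x * a * x" by (simp add: commutator_eq_0_iff mult.assoc)
  then have "a * x * x = 0" by (simp add: xa)
  then have "a * x ^ 8 = 0" by (simp add: eval_nat_numeral flip: mult.assoc)
  then have "a * x = 0" using eighth_power_left_right(2)[of x "x ^ 7 * y + y"] by (simp add: a_def)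
  then have "commutator x a = 0" by (simp add: commutator_char2 xa)
  then have "a = 0" unfolding a_def by (rule commutator_kernel)
  then show "x ^ 7 * commutator x y = commutator x y" by (simp add: a add_eq_0_char2)
next
  define a where "a = commutator x (y * x ^ 7 + y)"
  have a: "a = commutator x y * x ^ 7 + commutator x y"
    by (simp add: a_def commutator_char2 eval_nat_numeral algebra_simps)
  have ax: "a * x = 0"
    using eighth_power_left_right(2)[of x y] by (simp add: a eval_nat_numeral algebra_simps)
  have "(x * a)\<^sup>2 = x * (a * x) * a" by (simp add: power2_eq_square mult.assoc)
  then have "commutator (x * a) x = 0" by (intro square_zero_central) (simp add: ax)
  then have "x * (x * a) = 0" by (simp add: commutator_eq_0_iff ax mult.assoc)
  then have "x ^ 8 * a = 0" by (simp add: eval_nat_numeral mult.assoc)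
  then have "x * a = 0" using eighth_power_left_right(1)[of x "y * x ^ 7 + y"] by (simp add: a_def)
  then have "commutator x a = 0" by (simp add: commutator_char2 ax)
  then have "a = 0" unfolding a_def by (rule commutator_kernel)
  then show "commutator x y * x ^ 7 = commutator x y" by (simp add: a add_eq_0_char2)
qed

text \<open>\<open>x + 1\<close> has the same commutators as \<open>x\<close>, so
  \<open>(x + 1)^7\<close> and \<open>x^7\<close> both fix them; all binomial coefficients of the
  former are odd, which makes \<open>s\<close> the difference.\<close>

lemma cyclotomic_left_right:
  fixes x y :: 'a
  defines "s \<equiv> x ^ 6 + x ^ 5 + x ^ 4 + x ^ 3 + x\<^sup>2 + x + 1"
  shows "s * commutator x y = 0" and "commutator x y * s = 0"
proof -
  have 1: "(x + 1) ^ 7 = x ^ 7 + s"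
    by (simp add: s_def eval_nat_numeral algebra_simps)
  have 2: "commutator (x + 1) y = commutator x y"
    by (simp add: commutator_def algebra_simps)
  show "s * commutator x y = 0"
    using seventh_power_left_right(1)[of "x + 1" y] seventh_power_left_right(1)[of x y]
    unfolding 1 2 by (simp add: distrib_right)
  show "commutator x y * s = 0"
    using seventh_power_left_right(2)[of "x + 1" y] seventh_power_left_right(2)[of x y]
    unfolding 1 2 by (simp add: distrib_left)
qed

section \<open>Twisted commutation and the two cubic factors\<close>

lemma twist_power:
  fixes x v :: 'a
  assumes "x * v = v * x ^ k"
  shows "x ^ j * v = v * x ^ (k * j)" and "x * v ^ n = v ^ n * x ^ (k ^ n)"
proof -
  have 1: "x ^ j * v = v * x ^ (k * j)" for j
  proof (induction j)
    case (Suc j)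
    have "x ^ Suc j * v = x * v * x ^ (k * j)" by (simp add: Suc mult.assoc)
    then show ?case by (simp add: assms power_add mult.assoc)
  qed simp
  then show "x ^ j * v = v * x ^ (k * j)" .
  show "x * v ^ n = v ^ n * x ^ (k ^ n)"
  proof (induction n)
    case (Suc n)
    have "x * v ^ Suc n = v ^ n * (x ^ (k ^ n) * v)"
      by (simp only: power_Suc2 Suc flip: mult.assoc)
    then show ?case unfolding 1 by (simp only: power_Suc2 mult.assoc) (simp add: mult.commute)
  qed simp
qed

lemma twisted_commutator:
  fixes x v :: 'a
  assumes v: "v = commutator x y" and r: "v * x ^ 3 = v * x + v"
    and tw: "x * v = v * x ^ k" and k: "k = 2 \<or> k = 4"
  shows "v = 0"
proof -
  have v7: "v * x ^ 7 = v" using seventh_power_left_right(2)[of x y] by (simp add: v)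
  \<comment> \<open>To the right of \<open>v ^ 8\<close>, exponents of \<open>x\<close> count modulo
    7.\<close>
  have per: "v ^ 8 * x ^ (7 * m + j) = v ^ 8 * x ^ j" for m j
  proof (induction m)
    case (Suc m)
    have "v ^ 8 * x ^ (7 * Suc m + j) = v ^ 7 * (v * x ^ 7) * x ^ (7 * m + j)"
      by (simp add: power_add power_Suc2[of v 7, simplified] mult.assoc)
    then show ?case using Suc by (simp add: v7 power_Suc2[of v 7, simplified])
  qed simp
  have c: "v ^ 8 * x + x * v ^ 8 = v * x + x * v"
    using eighth_central[of v x] by (simp add: commutator_char2)
  have tw8: "x * v ^ 8 = v ^ 8 * x ^ (k ^ 8)" by (rule twist_power(2)[OF tw])
  have vv: "v * v ^ 8 = v ^ 8 * v" by (simp add: power_commutes)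
  have r': "v * x * x * x = v * x + v" using r by (simp add: eval_nat_numeral mult.assoc)
  have red8: "v ^ 8 * x * x * x = v ^ 8 * x + v ^ 8"
    using r' by (simp add: eval_nat_numeral mult.assoc distrib_left)
  have red2: "v * v * x * x * x = v * v * x + v * v"
    using r' by (simp add: mult.assoc distrib_left)
  have v8: "v ^ 8 * x ^ 7 = v ^ 8" using per[of 1 0] by simp
  \<comment> \<open>Modulo \<open>X^3 + X + 1\<close> one has \<open>X + X^4 = X^2\<close> and
    \<open>X + X^2 = X^4\<close>.\<close>
  have cubic:
    "\<lbrakk>g * x * x * x = g * x + g; v * x * x * x = v * x + v;
      g * x + g * x ^ 4 = v * x + v * x\<^sup>2\<rbrakk> \<Longrightarrow> g * x\<^sup>2 = v * x ^ 4"
    "\<lbrakk>g * x * x * x = g * x + g; v * x * x * x = v * x + v;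
      g * x + g * x\<^sup>2 = v * x + v * x ^ 4\<rbrakk> \<Longrightarrow> g * x ^ 4 = v * x\<^sup>2" for g
    by (simp_all add: eval_nat_numeral distrib_right add_ac flip: mult.assoc)
  have "v * v * x = 0"
    using k
  proof
    assume k: "k = 2"
    \<comment> \<open>Here \<open>2^8 = 7 * 36 + 4\<close>.\<close>
    have "v ^ 8 * x + v ^ 8 * x ^ 4 = v * x + v * x\<^sup>2"
      using c tw tw8 per[of 36 4] k by simp
    then have "v ^ 8 * x\<^sup>2 = v * x ^ 4" using red8 r' by (intro cubic(1))
    then have "v ^ 8 * x\<^sup>2 * x ^ 5 = v * x ^ 4 * x ^ 5" by simp
    then have "v ^ 8 = v * x ^ 7 * x\<^sup>2"
      by (simp add: mult.assoc v8 flip: power_add)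
    then have v8: "v ^ 8 = v * x\<^sup>2" by (simp add: v7)
    \<comment> \<open>\<open>v\<close> commutes with \<open>v ^ 8\<close>; pulling \<open>v\<close>
      through \<open>x^2\<close> doubles the exponent, and \<open>x^2 + x^4\<close> reduces to
      \<open>x\<close>.\<close>
    have "v * v * x\<^sup>2 = v * (x\<^sup>2 * v)" using vv by (simp add: v8 mult.assoc)
    also have "\<dots> = v * v * x ^ 4" using twist_power(1)[OF tw, of 2] k by (simp add: mult.assoc)
    finally show ?thesis using red2
      by (simp add: eval_nat_numeral distrib_right flip: mult.assoc)
  next
    assume k: "k = 4"
    \<comment> \<open>Here \<open>4^8 = 7 * 9362 + 2\<close>.\<close>
    have "v ^ 8 * x + v ^ 8 * x\<^sup>2 = v * x + v * x ^ 4"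
      using c tw tw8 per[of 9362 2] k by simp
    then have "v ^ 8 * x ^ 4 = v * x\<^sup>2" using red8 r' by (intro cubic(2))
    then have "v ^ 8 * x ^ 4 * x ^ 3 = v * x\<^sup>2 * x ^ 3" by simp
    then have v8: "v ^ 8 = v * x ^ 5"
      by (simp add: mult.assoc v8 flip: power_add)
    have "v * v * x ^ 5 = v * (x ^ 5 * v)" using vv by (simp add: v8 mult.assoc)
    also have "\<dots> = v * (v * x ^ 7 * x ^ 7 * x ^ 6)"
      using twist_power(1)[OF tw, of 5] k by (simp add: mult.assoc flip: power_add)
    also have "\<dots> = v * v * x ^ 6" by (simp add: v7 mult.assoc)
    finally show ?thesis using red2
      by (simp add: eval_nat_numeral distrib_right flip: mult.assoc)
  qed
  then have "v * (v * x ^ 7) = 0" by (simp add: eval_nat_numeral flip: mult.assoc)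
  then have "v * v = 0" by (simp only: v7)
  then show "v = 0" unfolding v by (intro commutator_square_zero) (simp add: power2_eq_square)
qed

lemma same_cubic_factor:
  fixes x u :: 'a
  assumes u: "u = commutator x y"
    and l: "x ^ 3 * u = x * u + u" and r: "u * x ^ 3 = u * x + u"
  shows "u = 0"
proof -
  have l': "x * (x * (x * u)) = x * u + u" using l by (simp add: eval_nat_numeral mult.assoc)
  have r': "u * (x * (x * x)) = u * x + u" using r by (simp add: eval_nat_numeral mult.assoc)
  have r'': "u * (x * (x * (x * t))) = u * (x * t) + u * t" for t
    using arg_cong[OF r', of "\<lambda>s. s * t"] by (simp add: mult.assoc distrib_right)
  note s = eval_nat_numeral algebra_simps l' r' r''
  txt \<open>With \<open>L\<close>, \<open>R\<close> the left and right multiplication by \<open>x\<close>,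
    \<open>L\<^sup>3 + L + 1 = (L + R) (L + R\<^sup>2) (L + R\<^sup>4)\<close> modulo \<open>R\<^sup>3 + R + 1\<close>.\<close>
  define a where "a = x * u + u * x"
  define b where "b = x * a + a * x ^ 4"
  define c where "c = x * b + b * x\<^sup>2"
  have "c = 0"
  proof -
    have "commutator x c = 0" by (simp add: commutator_char2 a_def b_def c_def s)
    moreover have "c = commutator x (x * (x * (x*y+y*x) + (x*y+y*x) * x^4)
        + (x * (x*y+y*x) + (x*y+y*x) * x^4) * x^2)"
      unfolding a_def b_def c_def u
      by (simp add: commutator_char2 eval_nat_numeral algebra_simps)
    ultimately show ?thesis using commutator_kernel by metis
  qed
  \<comment> \<open>The factors are peeled off in turn: \<open>c = 0\<close> is the twist relation
    of \<open>b\<close> with exponent 2, and \<open>b = 0\<close> that of \<open>a\<close> with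
    exponent 4.\<close>
  have "b = 0"
  proof (rule twisted_commutator)
    show "b = commutator x (x * (x*y+y*x) + (x*y+y*x) * x^4)"
      unfolding a_def b_def u by (simp add: commutator_char2 eval_nat_numeral algebra_simps)
    show "b * x ^ 3 = b * x + b" by (simp add: a_def b_def s)
    show "x * b = b * x\<^sup>2" using \<open>c = 0\<close> by (simp add: c_def add_eq_0_char2)
  qed simp
  have "a = 0"
  proof (rule twisted_commutator)
    show "a = commutator x (x*y+y*x)"
      unfolding a_def u by (simp add: commutator_char2 eval_nat_numeral algebra_simps)
    show "a * x ^ 3 = a * x + a" by (simp add: a_def s)
    show "x * a = a * x ^ 4" using \<open>b = 0\<close> by (simp add: b_def add_eq_0_char2)
  qed simp
  then have "commutator x u = 0" by (simp add: a_def commutator_char2)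
  then show ?thesis unfolding u by (rule commutator_kernel)
qed

text \<open>The sequence \<open>u * x ^ k * u\<close> obeys linear recurrences with two coprime
  characteristic polynomials, so it vanishes, in particular at \<open>k = 0\<close>.\<close>

lemma opposite_cubic_factors:
  fixes x u :: 'a
  assumes u: "u = commutator x y"
    and l: "x ^ 3 * u = x * u + u" and r: "u * x ^ 3 = u * x\<^sup>2 + u"
  shows "u = 0"
  unfolding u
proof (rule commutator_square_zero, fold u)
  define S where "S k = u * x ^ k * u" for k
  have L: "S (k + 3) = S (k + 1) + S k" for k
    using arg_cong[OF l, of "\<lambda>t. u * x ^ k * t"]
    by (simp only: S_def power_add power_one_right distrib_left mult.assoc)
  have R: "S (3 + k) = S (2 + k) + S k" for k
    using arg_cong[OF r, of "\<lambda>t. t * x ^ k * u"]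
    by (simp only: S_def power_add distrib_right mult.assoc)
  have "S 3 = S 1 + S 0" "S 3 = S 2 + S 0" using L[of 0] R[of 0] by simp_all
  moreover have "S 4 = S 2 + S 1" using L[of 1] by (simp add: eval_nat_numeral)
  moreover have "S 4 = S 3 + S 1" using R[of 1] by (simp add: eval_nat_numeral)
  ultimately have "S 0 = 0" by (metis add_right_cancel add_cancel_right_right)
  then show "u\<^sup>2 = 0" by (simp add: S_def power2_eq_square)
qed

text \<open>Commutators are killed by \<open>p * q\<close> on both sides. So
  \<open>q * u * p\<close> is killed by \<open>p\<close> on the left and \<open>q\<close> on the
  right and is 0; then \<open>p\<close> kills \<open>q * u\<close> on both sides, so this is 0
  too.\<close>

lemma left_cubic_factor:
  fixes x y :: 'a
  shows "x ^ 3 * commutator x y = x\<^sup>2 * commutator x y + commutator x y"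
proof -
  define u where "u = commutator x y"
  define p where "p = x ^ 3 + x + 1"
  define q where "q = x ^ 3 + x\<^sup>2 + 1"
  have pq: "p * q = x ^ 6 + x ^ 5 + x ^ 4 + x ^ 3 + x\<^sup>2 + x + 1" "q * p = p * q"
    by (simp_all add: p_def q_def eval_nat_numeral algebra_simps)
  have s: "p * (q * v) = 0" "v * p * q = 0" if "v = commutator x z" for v z
    using cyclotomic_left_right[of x z] unfolding that pq(1)[symmetric]
    by (simp_all add: mult.assoc)
  have com: "commutator x (q * z * t) = q * commutator x z * t" if "x * t = t * x" for z t
  proof -
    have "x * q = q * x" by (simp add: q_def eval_nat_numeral algebra_simps)
    then have "x * (q * w) = q * (x * w)" for w by (metis mult.assoc)
    then show ?thesis using that by (simp add: commutator_def algebra_simps)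
  qed
  have p0: "q * u * p = 0"
  proof (rule opposite_cubic_factors)
    show "q * u * p = commutator x (q * y * p)" unfolding u_def
      by (rule com[symmetric]) (simp add: p_def eval_nat_numeral algebra_simps)
    have "p * (q * u * p) = 0" using s(1)[OF u_def] by (metis mult.assoc mult_zero_left)
    then show "x ^ 3 * (q * u * p) = x * (q * u * p) + q * u * p"
      by (subst (asm) p_def) (simp add: distrib_right add_eq_0_char2 add.assoc)
    have "q * u * p * q = 0" using s(2)[OF u_def] by (metis mult.assoc mult_zero_right)
    then show "q * u * p * x ^ 3 = q * u * p * x\<^sup>2 + q * u * p"
      by (subst (asm) (2) q_def) (simp add: distrib_left add_eq_0_char2 add.assoc)
  qed
  have "q * u = 0"
  proof (rule same_cubic_factor)
    show "q * u = commutator x (q * y)" using com[of 1 y] by (simp add: u_def)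
    show "x ^ 3 * (q * u) = x * (q * u) + q * u"
      using s(1)[OF u_def] by (subst (asm) p_def) (simp add: distrib_right add_eq_0_char2 add.assoc)
    show "q * u * x ^ 3 = q * u * x + q * u"
      using p0 by (subst (asm) p_def) (simp add: distrib_left add_eq_0_char2 add.assoc)
  qed
  then show ?thesis by (simp add: q_def u_def distrib_right add_eq_0_char2 add.assoc)
qed

lemma commutative: "x * y = y * (x::'a)"
proof -
  have l: "x * (x * (x * commutator x z)) = x * (x * commutator x z) + commutator x z" for z
    using left_cubic_factor[of x z] by (simp add: eval_nat_numeral mult.assoc)
  txt \<open>\<open>x\<close> acts as a root of \<open>X\<^sup>3 + X\<^sup>2 + 1\<close>, so \<open>x\<^sup>3\<close> would act as a root of both cubics.\<close>
  have t: "commutator (x ^ 3) z = 0" for z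
  proof -
    define c where "c = commutator (x ^ 3) z"
    have "c = commutator x (x\<^sup>2 * z + x * z * x + z * x\<^sup>2)"
      by (simp add: c_def commutator_char2 eval_nat_numeral algebra_simps)
    then have c: "x * (x * (x * c)) = x * (x * c) + c" using l by simp
    have 1: "x * (x * c) = x * (x * c) + x * c + c"
      using left_cubic_factor[of "x ^ 3" z] unfolding c_def[symmetric]
      by (simp add: c eval_nat_numeral mult.assoc distrib_left ac_simps)
    then have "x * c = c"
      by (metis add.assoc add_cancel_right_right add_eq_0_char2)
    then show "c = 0" using c by simp
  qed
  define u where "u = commutator x y"
  have "central (x ^ 3)" using t by (simp add: central_def commutator_eq_0_iff)
  \<comment> \<open>Modulo \<open>X^3 + X^2 + 1\<close>, \<open>X^6 = X^3\<close> reads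
    \<open>X^2 + X = X^2 + 1\<close>.\<close>
  from central_idempotent[OF this, of x y] have "x * u = u"
    using l[of y, folded u_def]
    by (simp add: eval_nat_numeral mult.assoc distrib_left ac_simps flip: u_def)
  then have "u = 0" using l[of y, folded u_def] by simp
  then show ?thesis by (simp add: u_def commutator_eq_0_iff)
qed
end

section \<open>Reduction to unital rings of characteristic two\<close>

quotient_type (overloaded) 'a mod2 = "'a::ring" / "\<lambda>x y. \<exists>z. x - y = z + z"
proof (rule equivpI)
  show "reflp (\<lambda>x y::'a. \<exists>z. x - y = z + z)"
    by (rule reflpI, rule exI[of _ 0]) simp
  show "symp (\<lambda>x y::'a. \<exists>z. x - y = z + z)"
    by (rule sympI) (metis minus_add_distrib minus_diff_eq)
  show "transp (\<lambda>x y::'a. \<exists>z. x - y = z + z)"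
  proof (rule transpI, elim exE)
    fix x y z a b :: 'a
    assume "x - y = a + a" "y - z = b + b"
    then have "x - z = (a + b) + (a + b)" by (simp add: algebra_simps)
    then show "\<exists>c. x - z = c + c" ..
  qed
qed

instantiation mod2 :: (ring) char2_ring
begin

lift_definition zero_mod2 :: "'a mod2" is 0 .

lift_definition plus_mod2 :: "'a mod2 \<Rightarrow> 'a mod2 \<Rightarrow> 'a mod2" is "(+)"
proof (elim exE)
  fix a a' b b' s t :: 'a
  assume "a - a' = s + s" "b - b' = t + t"
  then have "a + b - (a' + b') = (s + t) + (s + t)" by (simp add: algebra_simps)
  then show "\<exists>z. a + b - (a' + b') = z + z" ..
qed

lift_definition uminus_mod2 :: "'a mod2 \<Rightarrow> 'a mod2" is uminus
proof (elim exE)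
  fix a a' s :: 'a
  assume "a - a' = s + s"
  then have "- a - - a' = (- s) + (- s)" by (simp add: algebra_simps)
  then show "\<exists>z. - a - - a' = z + z" ..
qed

lift_definition minus_mod2 :: "'a mod2 \<Rightarrow> 'a mod2 \<Rightarrow> 'a mod2" is "(-)"
proof (elim exE)
  fix a a' b b' s t :: 'a
  assume "a - a' = s + s" "b - b' = t + t"
  then have "a - b - (a' - b') = (s - t) + (s - t)" by (simp add: algebra_simps)
  then show "\<exists>z. a - b - (a' - b') = z + z" ..
qed

lift_definition times_mod2 :: "'a mod2 \<Rightarrow> 'a mod2 \<Rightarrow> 'a mod2" is "(*)"
proof (elim exE)
  fix a a' b b' s t :: 'a
  assume "a - a' = s + s" "b - b' = t + t"
  then have "a = a' + s + s" "b = b' + t + t" by (simp_all add: algebra_simps)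
  then have "a * b - a' * b' = (s * b + a' * t) + (s * b + a' * t)" by (simp add: algebra_simps)
  then show "\<exists>z. a * b - a' * b' = z + z" ..
qed

instance
proof
  fix a b c :: "'a mod2"
  show "a * b * c = a * (b * c)" by transfer (rule exI[of _ 0], simp add: mult.assoc)
  show "a + b + c = a + (b + c)" by transfer (rule exI[of _ 0], simp add: add.assoc)
  show "a + b = b + a" by transfer (rule exI[of _ 0], simp)
  show "0 + a = a" by transfer (rule exI[of _ 0], simp)
  show "- a + a = 0" by transfer (rule exI[of _ 0], simp)
  show "a - b = a + - b" by transfer (rule exI[of _ 0], simp)
  show "(a + b) * c = a * c + b * c" by transfer (rule exI[of _ 0], simp add: distrib_right)
  show "a * (b + c) = a * b + a * c" by transfer (rule exI[of _ 0], simp add: distrib_left)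
  show "a + a = 0" by transfer auto
qed

end

text \<open>The Boolean is a scalar in \<open>F_2\<close>; the pair stands for
  \<open>m 1 + a\<close>.\<close>

datatype 'a unitization = Unitization bool 'a

fun add_unitization :: "'a::char2_ring unitization \<Rightarrow> 'a unitization \<Rightarrow> 'a unitization" where
  "add_unitization (Unitization m a) (Unitization n b) = Unitization (m \<noteq> n) (a + b)"

fun mult_unitization :: "'a::char2_ring unitization \<Rightarrow> 'a unitization \<Rightarrow> 'a unitization" where
  "mult_unitization (Unitization m a) (Unitization n b) =
     Unitization (m \<and> n) (a * b + (if m then b else 0) + (if n then a else 0))"

instantiation unitization :: (char2_ring) "{char2_ring, ring_1}"
begin

definition "0 = Unitization False 0"
definition "1 = Unitization True 0"
definition "a + b = add_unitization a b"
definition "a * b = mult_unitization a b"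
definition "- a = (a :: 'a unitization)"
definition "a - b = add_unitization a b"

instance
proof
  fix a b c :: "'a unitization"
  note defs = zero_unitization_def one_unitization_def plus_unitization_def times_unitization_def
    uminus_unitization_def minus_unitization_def
  show "a * b * c = a * (b * c)"
    by (cases a; cases b; cases c) (simp add: defs algebra_simps)
  show "a + b + c = a + (b + c)"
    by (cases a; cases b; cases c) (auto simp: defs algebra_simps)
  show "a + b = b + a" by (cases a; cases b) (auto simp: defs algebra_simps)
  show "0 + a = a" by (cases a) (simp add: defs)
  show "- a + a = 0" by (cases a) (simp add: defs)
  show "a - b = a + - b" by (simp add: defs)
  show "(a + b) * c = a * c + b * c"
    by (cases a; cases b; cases c) (auto simp: defs algebra_simps)
  show "a * (b + c) = a * b + a * c"
    by (cases a; cases b; cases c) (auto simp: defs algebra_simps)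
  show "1 * a = a" "a * 1 = a" by (cases a; simp add: defs)+
  show "(0 :: 'a unitization) \<noteq> 1" by (simp add: defs)
  show "a + a = 0" by (cases a) (simp add: defs)
qed

end
lemma commutator_mod2:
  assumes "\<forall>x y :: 'a::ring. commutator (eighth_power x - x) y = 0"
  shows "commutator (eighth_power a - a) (b :: 'a mod2) = 0"
  using assms unfolding commutator_def eighth_power_def by transfer (rule exI[of _ 0], simp)

text \<open>In characteristic 2 the cross terms of a square with a scalar cancel; squaring three
  times gives the eighth power.\<close>

lemma Unitization_power8:
  "Unitization m a ^ 8 = Unitization m (eighth_power (a::'a::char2_ring))"
proof -
  have sq: "(Unitization m b)\<^sup>2 = Unitization m (b * b)" for b :: 'a
    by (simp add: power2_eq_square times_unitization_def)
  have "Unitization m a ^ 8 = (((Unitization m a)\<^sup>2)\<^sup>2)\<^sup>2" by simp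
  also have "\<dots> = Unitization m (eighth_power a)"
    by (simp only: sq eighth_power_def mult.assoc)
  finally show ?thesis .
qed

lemma commutator_Unitization:
  "commutator (Unitization m a) (Unitization n b) = Unitization False (commutator a b)"
  by (auto simp: commutator_char2 plus_unitization_def times_unitization_def algebra_simps)

lemma eighth_power_central_unitization:
  assumes "\<And>a b :: 'a::char2_ring. commutator (eighth_power a - a) b = 0"
  shows "eighth_power_central TYPE('a unitization)"
proof
  fix x y :: "'a unitization"
  obtain m a n b where xy: "x = Unitization m a" "y = Unitization n b"
    by (metis unitization.exhaust)
  have "commutator (eighth_power a) b = commutator a b"
    using assms[of a b] by (simp add: commutator_def distrib_left distrib_right)
      (metis add_eq_0_char2 add.assoc add.left_commute)
  then show "commutator (x ^ 8) y = commutator x y"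
    by (simp add: xy Unitization_power8 commutator_Unitization)
qed

theorem theorem3p8:
  assumes "\<forall>x y :: 'a::ring. commutator (eighth_power x - x) y = 0"
  shows "\<forall>x y :: 'a. x * y = y * x"
proof (intro allI)
  fix x y :: 'a
  interpret eighth_power_central "TYPE('a mod2 unitization)"
    by (intro eighth_power_central_unitization commutator_mod2 assms)
  have "a * b = b * a" for a b :: "'a mod2"
    using commutative[of "Unitization False a" "Unitization False b"]
    by (simp add: times_unitization_def)
  then have mod2: "\<exists>z. a * b - b * a = z + z" for a b :: 'a
    by transfer
  have eighth: "eighth_power a * b - b * eighth_power a = a * b - b * a" for a b :: 'a
    using assms[rule_format, of a b] by (simp add: commutator_def algebra_simps)
  \<comment> \<open>Replacing \<open>a\<close> by \<open>- a\<close> fixes the eighth power but negates the linear term.\<close>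
  have double: "(a + a) * b = b * (a + a)" for a b :: 'a
  proof -
    have "a * b - b * a = b * a - a * b"
      using eighth[of a b] eighth[of "- a" b] by (simp add: eighth_power_def)
    then show ?thesis by (simp add: algebra_simps)
  qed
  have sq: "a * a * b = b * (a * a)" for a b :: 'a
  proof -
    define c where "c = a * b - b * a"
    have "c + c = 0" using double[of a b] by (simp add: c_def algebra_simps)
    \<comment> \<open>\<open>c\<close> is itself a double, hence central.\<close>
    moreover have "a * c = c * a" using mod2[of a b] double by (metis c_def)
    ultimately have "a * c + c * a = 0" by (metis distrib_left mult_zero_right)
    then show ?thesis by (simp add: c_def algebra_simps)
  qed
  have "eighth_power x * y = y * eighth_power x"
    using sq[of "x * x * x * x" y] by (simp add: eighth_power_def mult.assoc)
  then show "x * y = y * x" using eighth[of x y] by simp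
qed

end
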